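(* For any compact space $K$ the following conditions are equivalent: (i) $K$ is $\omega$-Corson; (ii) the Alexandroff duplicate $AD(K)$ is $\omega$-Corson; (iii) the Alexandroff duplicate $AD(K)$ is $\omega$-Valdivia compact.
   Context: All spaces are assumed to be Tychonoff; in particular compact spaces are Hausdorff. The Alexandroff duplicate $AD(X)$ of a space $X$ is the set $X\times\{0,1\}$ with the following topology: points of $X\times\{1\}$ are isolated, and a basic open neighborhood of $(x,0)$ is of the form $(U\times\{0,1\})\setminus\{(x,1)\}$, where $U$ is an open neighborhood of $x$ in $X$. For a set $\Gamma$ let $\sigma([0,1]^\Gamma)=\{x\in[0,1]^\Gamma:\{\gamma\in\Gamma:x_\gamma\neq0\}\text{ is finite}\}$. A compact space $K$ is $\omega$-Corson if, for some set $\Gamma$, $K$ embeds homeomorphically into $\sigma([0,1]^\Gamma)$. A compact space $K$ is $\omega$-Valdivia if, for some set $\Gamma$, there is a homeomorphic embedding $h:K\to[0,1]^\Gamma$ such that $h(K)\cap\sigma([0,1]^\Gamma)$ is dense in $h(K)$. *)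

theory Defs
  imports "HOL-Analysis.Analysis"
begin

text \<open>The second coordinate is of type \<^typ>\<open>bool\<close>: \<^term>\<open>False\<close> stands for $0$ and
  \<^term>\<open>True\<close> for $1$. A set is open iff it contains a basic neighbourhood of each of its
  points \<open>(x, False)\<close>; the points \<open>(x, True)\<close> are isolated and impose no condition.\<close>

definition alexandroff_duplicate :: "'a topology \<Rightarrow> ('a \<times> bool) topology" where
  "alexandroff_duplicate X = topology (\<lambda>W. W \<subseteq> topspace X \<times> UNIV \<and>
     (\<forall>x. (x, False) \<in> W \<longrightarrow>
        (\<exists>U. openin X U \<and> x \<in> U \<and> U \<times> UNIV - {(x, True)} \<subseteq> W)))"

lemma istopology_alexandroff_duplicate:
  "istopology (\<lambda>W. W \<subseteq> topspace X \<times> UNIV \<and>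
     (\<forall>x. (x, False) \<in> W \<longrightarrow>
        (\<exists>U. openin X U \<and> x \<in> U \<and> U \<times> UNIV - {(x, True)} \<subseteq> W)))"
  (is "istopology ?P")
  unfolding istopology_def
proof (intro conjI allI impI)
  fix S T assume S: "?P S" and T: "?P T"
  then show "S \<inter> T \<subseteq> topspace X \<times> UNIV" by blast
  fix x assume x: "(x, False) \<in> S \<inter> T"
  from S x obtain U where "openin X U" "x \<in> U" "U \<times> UNIV - {(x, True)} \<subseteq> S" by blast
  moreover from T x obtain V where "openin X V" "x \<in> V" "V \<times> UNIV - {(x, True)} \<subseteq> T" by blast
  ultimately show "\<exists>U. openin X U \<and> x \<in> U \<and> U \<times> UNIV - {(x, True)} \<subseteq> S \<inter> T"
    by (intro exI [of _ "U \<inter> V"]) blast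
next
  fix \<W> assume \<W>: "\<forall>W\<in>\<W>. ?P W"
  then show "\<Union>\<W> \<subseteq> topspace X \<times> UNIV" by blast
  fix x assume "(x, False) \<in> \<Union>\<W>"
  then obtain W where W: "W \<in> \<W>" "(x, False) \<in> W" by blast
  from W(1) \<W> have "?P W" by simp
  with W(2) obtain U where "openin X U" "x \<in> U" "U \<times> UNIV - {(x, True)} \<subseteq> W" by metis
  with W(1) show "\<exists>U. openin X U \<and> x \<in> U \<and> U \<times> UNIV - {(x, True)} \<subseteq> \<Union>\<W>"
    by (meson Union_upper subset_trans)
qed

lemma openin_alexandroff_duplicate:
  "openin (alexandroff_duplicate X) W \<longleftrightarrow> W \<subseteq> topspace X \<times> UNIV \<and>
     (\<forall>x. (x, False) \<in> W \<longrightarrow>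
        (\<exists>U. openin X U \<and> x \<in> U \<and> U \<times> UNIV - {(x, True)} \<subseteq> W))"
  unfolding alexandroff_duplicate_def
  by (subst topology_inverse' [OF istopology_alexandroff_duplicate]) (rule refl)

lemma topspace_alexandroff_duplicate [simp]:
  "topspace (alexandroff_duplicate X) = topspace X \<times> UNIV"
proof
  show "topspace (alexandroff_duplicate X) \<subseteq> topspace X \<times> UNIV"
    using openin_alexandroff_duplicate [of X] openin_topspace by blast
  have "openin (alexandroff_duplicate X) (topspace X \<times> UNIV)"
    unfolding openin_alexandroff_duplicate by blast
  then show "topspace X \<times> UNIV \<subseteq> topspace (alexandroff_duplicate X)"
    by (rule openin_subset)
qed

lemma openin_alexandroff_duplicate_isolated:
  "x \<in> topspace X \<Longrightarrow> openin (alexandroff_duplicate X) {(x, True)}"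
  by (simp add: openin_alexandroff_duplicate)

lemma openin_alexandroff_duplicate_basic:
  assumes "t1_space X" and U: "openin X U"
  shows "openin (alexandroff_duplicate X) (U \<times> UNIV - {(x, True)})"
  unfolding openin_alexandroff_duplicate
proof (intro conjI allI impI)
  show "U \<times> UNIV - {(x, True)} \<subseteq> topspace X \<times> UNIV"
    using openin_subset [OF U] by auto
  fix y assume "(y, False) \<in> U \<times> UNIV - {(x, True)}"
  then have y: "y \<in> U" by simp
  show "\<exists>V. openin X V \<and> y \<in> V \<and> V \<times> UNIV - {(y, True)} \<subseteq> U \<times> UNIV - {(x, True)}"
  proof (cases "y = x")
    case True
    with U y show ?thesis by (intro exI [of _ U]) auto
  next
    case False
    have "openin X (U - {x})"
      using assms by (simp add: t1_space_openin_delete_alt)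
    with y False show ?thesis by (intro exI [of _ "U - {x}"]) auto
  qed
qed

definition cube :: "'i set \<Rightarrow> ('i \<Rightarrow> real) topology" where
  "cube \<Gamma> = product_topology (\<lambda>_. top_of_set {0..1}) \<Gamma>"

definition sigma_cube :: "'i set \<Rightarrow> ('i \<Rightarrow> real) set" where
  "sigma_cube \<Gamma> = {x \<in> topspace (cube \<Gamma>). finite {\<gamma> \<in> \<Gamma>. x \<gamma> \<noteq> 0}}"

text \<open>A definition in HOL cannot quantify over an index set of arbitrary type, so \<open>\<Gamma>\<close> ranges over
  sets of real functions on the space. This loses no generality: an embedding into a cube over
  an index set of any type can be reindexed by its coordinate functions, as
  \<open>omega_CorsonI\<close> and \<open>omega_ValdiviaI\<close> below show.\<close>

definition omega_Corson :: "'a topology \<Rightarrow> bool" where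
  "omega_Corson K \<longleftrightarrow> compact_space K \<and> Hausdorff_space K \<and>
     (\<exists>(\<Gamma> :: ('a \<Rightarrow> real) set) h. embedding_map K (subtopology (cube \<Gamma>) (sigma_cube \<Gamma>)) h)"

definition omega_Valdivia :: "'a topology \<Rightarrow> bool" where
  "omega_Valdivia K \<longleftrightarrow> compact_space K \<and> Hausdorff_space K \<and>
     (\<exists>(\<Gamma> :: ('a \<Rightarrow> real) set) h. embedding_map K (cube \<Gamma>) h \<and>
        subtopology (cube \<Gamma>) (h ` topspace K) closure_of (h ` topspace K \<inter> sigma_cube \<Gamma>)
          = h ` topspace K)"

lemma topspace_cube: "topspace (cube \<Gamma>) = (\<Pi>\<^sub>E i\<in>\<Gamma>. {0..1})"
  by (simp add: cube_def)

lemma Hausdorff_space_cube: "Hausdorff_space (cube \<Gamma>)"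
  by (simp add: cube_def Hausdorff_space_product_topology Hausdorff_space_subtopology)

lemma embedding_map_imp_continuous_map:
  assumes "embedding_map X Y f"
  shows "continuous_map X Y f"
proof -
  have "continuous_map X (subtopology Y (f ` topspace X)) f"
    using assms unfolding embedding_map_def by (rule homeomorphic_imp_continuous_map)
  then show ?thesis by (simp add: continuous_map_in_subtopology)
qed

lemma embedding_map_cube_reindex:
  fixes \<Gamma> :: "'i set" and K :: "'a topology"
  assumes K: "compact_space K" and h: "embedding_map K (cube \<Gamma>) h"
  obtains \<Delta> :: "('a \<Rightarrow> real) set" and r where
    "continuous_map (cube \<Gamma>) (cube \<Delta>) r" "r ` sigma_cube \<Gamma> \<subseteq> sigma_cube \<Delta>"
    "embedding_map K (cube \<Delta>) (r \<circ> h)"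
proof -
  define q where "q = (\<lambda>\<gamma> x. h x \<gamma>)"
  define s where "s = inv_into \<Gamma> q"
  define \<Delta> where "\<Delta> = q ` \<Gamma>"
  define r :: "('i \<Rightarrow> real) \<Rightarrow> ('a \<Rightarrow> real) \<Rightarrow> real" where "r = (\<lambda>y. \<lambda>g\<in>\<Delta>. y (s g))"
  have s: "s g \<in> \<Gamma>" "q (s g) = g" if "g \<in> \<Delta>" for g
    using that unfolding s_def \<Delta>_def by (fact inv_into_into, fact f_inv_into_f)
  have r: "continuous_map (cube \<Gamma>) (cube \<Delta>) r"
    unfolding cube_def continuous_map_componentwise
  proof (intro conjI ballI)
    show "r ` topspace (product_topology (\<lambda>_. top_of_set {0..1}) \<Gamma>) \<subseteq> extensional \<Delta>"
      by (auto simp: r_def)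
    fix g assume g: "g \<in> \<Delta>"
    have "continuous_map (product_topology (\<lambda>_. top_of_set {0..1::real}) \<Gamma>) (top_of_set {0..1})
        (\<lambda>y. y (s g))"
      by (rule continuous_map_product_projection) (rule s(1) [OF g])
    then show "continuous_map (product_topology (\<lambda>_. top_of_set {0..1}) \<Gamma>) (top_of_set {0..1})
        (\<lambda>y. r y g)"
      using g by (simp add: r_def)
  qed
  moreover have "r ` sigma_cube \<Gamma> \<subseteq> sigma_cube \<Delta>"
  proof
    fix z assume "z \<in> r ` sigma_cube \<Gamma>"
    then obtain y where z: "z = r y" and y: "y \<in> topspace (cube \<Gamma>)" "finite {\<gamma> \<in> \<Gamma>. y \<gamma> \<noteq> 0}"
      by (auto simp: sigma_cube_def)
    have "{g \<in> \<Delta>. r y g \<noteq> 0} \<subseteq> q ` {\<gamma> \<in> \<Gamma>. y \<gamma> \<noteq> 0}"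
    proof
      fix g assume "g \<in> {g \<in> \<Delta>. r y g \<noteq> 0}"
      then have "g \<in> \<Delta>" "y (s g) \<noteq> 0" by (auto simp: r_def)
      then show "g \<in> q ` {\<gamma> \<in> \<Gamma>. y \<gamma> \<noteq> 0}"
        using s [of g] by (intro image_eqI [of _ _ "s g"]) auto
    qed
    then have "finite {g \<in> \<Delta>. r y g \<noteq> 0}"
      using y(2) finite_surj by blast
    moreover have "r y \<in> topspace (cube \<Delta>)"
      using continuous_map_image_subset_topspace [OF r] y(1) by blast
    ultimately show "z \<in> sigma_cube \<Delta>"
      by (simp add: sigma_cube_def z)
  qed
  moreover have "embedding_map K (cube \<Delta>) (r \<circ> h)"
  proof (rule continuous_imp_embedding_map)
    have hc: "continuous_map K (cube \<Gamma>) h"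
      using h by (rule embedding_map_imp_continuous_map)
    then show "continuous_map K (cube \<Delta>) (r \<circ> h)"
      using r by (rule continuous_map_compose)
    have hE: "h x \<in> extensional \<Gamma>" if "x \<in> topspace K" for x
      using continuous_map_image_subset_topspace [OF hc] that
      by (auto simp: topspace_cube PiE_def)
    have inj: "inj_on h (topspace K)"
      using h unfolding embedding_map_def by (rule homeomorphic_imp_injective_map)
    show "inj_on (r \<circ> h) (topspace K)"
    proof (rule inj_onI)
      fix x y assume x: "x \<in> topspace K" and y: "y \<in> topspace K" and e: "(r \<circ> h) x = (r \<circ> h) y"
      have "h x \<gamma> = h y \<gamma>" if "\<gamma> \<in> \<Gamma>" for \<gamma>
      proof -
        have g: "q \<gamma> \<in> \<Delta>" using that by (simp add: \<Delta>_def)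
        have v: "r (h w) (q \<gamma>) = h w \<gamma>" for w
          using fun_cong [OF s(2) [OF g], of w] g by (simp add: r_def q_def)
        show ?thesis using e v [of x] v [of y] by simp
      qed
      then have "h x = h y"
        using hE [OF x] hE [OF y] by (intro extensionalityI)
      then show "x = y" using inj x y by (auto dest: inj_onD)
    qed
  qed (fact K, rule Hausdorff_space_cube)
  ultimately show thesis by (rule that)
qed

lemma embedding_map_sigma_cube_iff:
  "embedding_map K (subtopology (cube \<Gamma>) (sigma_cube \<Gamma>)) h \<longleftrightarrow>
     embedding_map K (cube \<Gamma>) h \<and> h ` topspace K \<subseteq> sigma_cube \<Gamma>"
  by (auto simp: embedding_map_in_subtopology)

lemma omega_CorsonI:
  fixes \<Gamma> :: "'i set"
  assumes "compact_space K" "Hausdorff_space K"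
    and h: "embedding_map K (subtopology (cube \<Gamma>) (sigma_cube \<Gamma>)) h"
  shows "omega_Corson K"
proof -
  have h: "embedding_map K (cube \<Gamma>) h" "h ` topspace K \<subseteq> sigma_cube \<Gamma>"
    using h by (auto simp: embedding_map_sigma_cube_iff)
  obtain \<Delta> :: "('a \<Rightarrow> real) set" and r where
    sub: "r ` sigma_cube \<Gamma> \<subseteq> sigma_cube \<Delta>" and emb: "embedding_map K (cube \<Delta>) (r \<circ> h)"
    by (rule embedding_map_cube_reindex [OF assms(1) h(1)])
  have "(r \<circ> h) ` topspace K \<subseteq> sigma_cube \<Delta>"
    using sub h(2) by fastforce
  with emb have "embedding_map K (subtopology (cube \<Delta>) (sigma_cube \<Delta>)) (r \<circ> h)"
    unfolding embedding_map_sigma_cube_iff by (rule conjI)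
  with assms(1,2) show ?thesis
    unfolding omega_Corson_def by (intro conjI exI [of _ \<Delta>] exI [of _ "r \<circ> h"])
qed

lemma omega_ValdiviaI:
  fixes \<Gamma> :: "'i set"
  assumes "compact_space K" "Hausdorff_space K"
    and h: "embedding_map K (cube \<Gamma>) h"
    and dense: "subtopology (cube \<Gamma>) (h ` topspace K) closure_of (h ` topspace K \<inter> sigma_cube \<Gamma>)
          = h ` topspace K"
  shows "omega_Valdivia K"
proof -
  obtain \<Delta> :: "('a \<Rightarrow> real) set" and r where r: "continuous_map (cube \<Gamma>) (cube \<Delta>) r"
    and sub: "r ` sigma_cube \<Gamma> \<subseteq> sigma_cube \<Delta>" and emb: "embedding_map K (cube \<Delta>) (r \<circ> h)"
    by (rule embedding_map_cube_reindex [OF assms(1) h])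
  let ?A = "h ` topspace K" and ?B = "(r \<circ> h) ` topspace K"
  let ?Y = "subtopology (cube \<Delta>) ?B"
  have "?B \<subseteq> topspace (cube \<Delta>)"
    using emb by (intro continuous_map_image_subset_topspace embedding_map_imp_continuous_map)
  then have topY: "topspace ?Y = ?B" by auto
  have "continuous_map (subtopology (cube \<Gamma>) ?A) ?Y r"
    using r by (auto simp: continuous_map_in_subtopology intro: continuous_map_from_subtopology)
  then have "r ` (subtopology (cube \<Gamma>) ?A closure_of (?A \<inter> sigma_cube \<Gamma>))
      \<subseteq> ?Y closure_of (r ` (?A \<inter> sigma_cube \<Gamma>))"
    by (rule continuous_map_image_closure_subset)
  also have "\<dots> \<subseteq> ?Y closure_of (?B \<inter> sigma_cube \<Delta>)"
    using sub by (intro closure_of_mono) auto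
  finally have "?B \<subseteq> ?Y closure_of (?B \<inter> sigma_cube \<Delta>)"
    unfolding dense by (simp add: image_comp)
  moreover have "?Y closure_of (?B \<inter> sigma_cube \<Delta>) \<subseteq> ?B"
    using closure_of_subset_topspace [of ?Y] topY by blast
  ultimately have "?Y closure_of (?B \<inter> sigma_cube \<Delta>) = ?B" by (rule subset_antisym [rotated])
  with emb assms(1,2) show ?thesis
    unfolding omega_Valdivia_def by (intro conjI exI [of _ \<Delta>] exI [of _ "r \<circ> h"])
qed

end

theory Submission
  imports Defs
begin

text \<open>
  A compact space \<open>X\<close> is \<open>\<omega>\<close>-Corson iff its points are separated by a family of continuous functions
  into \<open>[0,1]\<close> that is point-finite: each point is a zero of all but finitely many members. All
  arguments are about such families.

  From \<open>K\<close> to its duplicate, pull the family back along the projection and add the indicators of the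
  isolated points \<open>(x, True)\<close>, of which at most one is nonzero at any given point. An \<open>\<omega>\<close>-Corson
  space is trivially \<open>\<omega>\<close>-Valdivia. The substance is the descent from an \<open>\<omega>\<close>-Valdivia duplicate
  to \<open>K\<close>.

  The isolated points of the duplicate belong to every dense subset, so a Valdivia embedding
  provides a separating family \<open>f\<close> on the duplicate that is point-finite at every \<open>(x, True)\<close>. Its
  restriction to the bottom level separates the points of \<open>K\<close>, but infinitely many \<open>f i\<close> may be
  nonzero at \<open>(x, False)\<close>. By compactness a continuous function on the duplicate satisfies
  \<open>\<bar>f (x, False) - f (x, True)\<bar> \<ge> e > 0\<close> for finitely many \<open>x\<close> only. Cutting every \<open>f i\<close> into pieces
  by a point-finite sequence of functions that separates the points of \<open>[0,1]\<close> and whose members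
  vanish near \<open>0\<close> therefore yields
  a separating family on \<open>K\<close> in which each member \<open>f i\<close> has a \<^emph>\<open>finite\<close> set \<open>C i\<close> of exceptions such that
  every \<open>x\<close> satisfies \<open>f i x = 0\<close> or \<open>x \<in> C i\<close> for all but finitely many \<open>i\<close>.

  Such a family can be repaired (\<open>point_finite_separating_family_of_exceptions\<close>). Let \<open>B\<close> be the set of
  points at which infinitely many members are nonzero. Each \<open>c \<in> B\<close> turns out to be the only zero
  of a continuous function, and hence has a peak function \<open>v c\<close> with value \<open>1\<close> exactly at \<open>c\<close>.
  Finiteness of the \<open>C i\<close> allows these to be chosen point-finite
  (\<open>peak_function_at_exceptional_point\<close>). The peak functions separate the points of \<open>B\<close> from all
  others, so \<open>f i\<close> needs to be retained only off \<open>C i \<inter> B\<close>: multiply it by the pieces of a function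
  that vanishes exactly on the finite set \<open>C i \<inter> B\<close>. For fixed \<open>i\<close>, all products vanish on
  \<open>C i \<inter> B\<close> and only finitely many are nonzero at any other point. A point of \<open>B\<close> thus meets
  products only for the finitely many \<open>i\<close> with \<open>f i\<close> nonzero there of which it is no exception, and
  at a point outside \<open>B\<close> only finitely many \<open>f i\<close> are nonzero in the first place.
\<close>

section \<open>Point-finite separating families of functions\<close>

definition separating_family :: "'a topology \<Rightarrow> 'i set \<Rightarrow> ('i \<Rightarrow> 'a \<Rightarrow> real) \<Rightarrow> bool" where
  "separating_family X I f \<longleftrightarrow>
     (\<forall>i\<in>I. continuous_map X (top_of_set {0..1}) (f i)) \<and>
     (\<forall>x\<in>topspace X. \<forall>y\<in>topspace X. (\<forall>i\<in>I. f i x = f i y) \<longrightarrow> x = y)"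

definition point_finite :: "'a topology \<Rightarrow> 'i set \<Rightarrow> ('i \<Rightarrow> 'a \<Rightarrow> real) \<Rightarrow> bool" where
  "point_finite X I f \<longleftrightarrow> (\<forall>x\<in>topspace X. finite {i\<in>I. f i x \<noteq> 0})"

lemma continuous_map_unit_interval:
  "continuous_map X (top_of_set {0..1}) f \<longleftrightarrow>
     continuous_map X euclideanreal f \<and> (\<forall>x\<in>topspace X. 0 \<le> f x \<and> f x \<le> (1::real))"
  by (auto simp: continuous_map_in_subtopology image_subset_iff Pi_iff)

lemma separating_familyI:
  assumes "\<And>i. i \<in> I \<Longrightarrow> continuous_map X (top_of_set {0..1}) (f i)"
    and "\<And>x y. x \<in> topspace X \<Longrightarrow> y \<in> topspace X \<Longrightarrow> (\<And>i. i \<in> I \<Longrightarrow> f i x = f i y) \<Longrightarrow> x = y"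
  shows "separating_family X I f"
  unfolding separating_family_def using assms by blast

lemma separating_family_continuous:
  "separating_family X I f \<Longrightarrow> i \<in> I \<Longrightarrow> continuous_map X euclideanreal (f i)"
  by (simp add: separating_family_def continuous_map_unit_interval)

lemma separating_family_bounds:
  assumes "separating_family X I f" "i \<in> I" "x \<in> topspace X"
  shows "0 \<le> f i x" "f i x \<le> 1"
  using assms by (auto simp: separating_family_def continuous_map_unit_interval)

lemma separating_family_eqI:
  assumes "separating_family X I f" "x \<in> topspace X" "y \<in> topspace X" "\<And>i. i \<in> I \<Longrightarrow> f i x = f i y"
  shows "x = y"
  using assms unfolding separating_family_def by blast

lemma continuous_map_into_cube:
  assumes "separating_family X I f"
  shows "continuous_map X (cube I) (\<lambda>x. \<lambda>i\<in>I. f i x)"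
  using assms unfolding cube_def continuous_map_componentwise separating_family_def
  by (auto intro: continuous_map_eq)

lemma inj_on_into_cube:
  assumes "separating_family X I f"
  shows "inj_on (\<lambda>x. \<lambda>i\<in>I. f i x) (topspace X)"
proof (rule inj_onI)
  fix x y assume xy: "x \<in> topspace X" "y \<in> topspace X" "(\<lambda>i\<in>I. f i x) = (\<lambda>i\<in>I. f i y)"
  then show "x = y"
    by (intro separating_family_eqI [OF assms]) (auto dest: fun_cong simp: restrict_def split: if_splits)
qed

lemma separating_family_imp_Hausdorff:
  "separating_family X I f \<Longrightarrow> Hausdorff_space X"
  by (rule Hausdorff_space_injective_preimage
      [OF Hausdorff_space_cube continuous_map_into_cube inj_on_into_cube])

text \<open>The evaluation map is an embedding because it is a continuous injection of a compact
  space into a Hausdorff one; point-finiteness says that its values lie in the \<open>\<sigma>\<close>-part. The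
  index type is arbitrary, so that families can be assembled from sums and products of index sets.\<close>

lemma separating_family_imp_omega_Corson:
  assumes "compact_space X" and f: "separating_family X I f" and fin: "point_finite X I f"
  shows "omega_Corson X"
proof (rule omega_CorsonI)
  show "embedding_map X (subtopology (cube I) (sigma_cube I)) (\<lambda>x. \<lambda>i\<in>I. f i x)"
    unfolding embedding_map_sigma_cube_iff
  proof
    show "embedding_map X (cube I) (\<lambda>x. \<lambda>i\<in>I. f i x)"
      by (rule continuous_imp_embedding_map [OF continuous_map_into_cube [OF f] assms(1)
            Hausdorff_space_cube inj_on_into_cube [OF f]])
    have "{i \<in> I. (\<lambda>i\<in>I. f i x) i \<noteq> 0} = {i \<in> I. f i x \<noteq> 0}" for x by auto
    then show "(\<lambda>x. \<lambda>i\<in>I. f i x) ` topspace X \<subseteq> sigma_cube I"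
      using fin continuous_map_into_cube [OF f]
      by (auto simp: sigma_cube_def point_finite_def continuous_map_def)
  qed
qed (use assms separating_family_imp_Hausdorff in auto)

lemma embedding_cube_imp_separating_family:
  assumes h: "embedding_map X (cube I) h"
  shows "separating_family X I (\<lambda>i x. h x i)"
proof (rule separating_familyI)
  have c: "continuous_map X (cube I) h"
    using h by (rule embedding_map_imp_continuous_map)
  show "continuous_map X (top_of_set {0..1}) (\<lambda>x. h x i)" if "i \<in> I" for i
    using continuous_map_product_then_coordinatewise(1) [OF c [unfolded cube_def] that] .
  fix x y assume xy: "x \<in> topspace X" "y \<in> topspace X" "\<And>i. i \<in> I \<Longrightarrow> h x i = h y i"
  have "h x \<in> extensional I" "h y \<in> extensional I"
    using continuous_map_image_subset_topspace [OF c] xy by (auto simp: topspace_cube PiE_def)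
  then have "h x = h y" using xy(3) by (rule extensionalityI)
  then show "x = y"
    using h xy unfolding embedding_map_def by (meson homeomorphic_imp_injective_map inj_onD)
qed

lemma omega_Corson_imp_separating_family:
  fixes X :: "'a topology"
  assumes "omega_Corson X"
  obtains I :: "('a \<Rightarrow> real) set" and f where "separating_family X I f" "point_finite X I f"
proof -
  from assms obtain I :: "('a \<Rightarrow> real) set" and h where
    h: "embedding_map X (cube I) h" "h ` topspace X \<subseteq> sigma_cube I"
    unfolding omega_Corson_def embedding_map_sigma_cube_iff by blast
  show thesis
    by (rule that [OF embedding_cube_imp_separating_family [OF h(1)]])
      (use h(2) in \<open>auto simp: point_finite_def sigma_cube_def\<close>)
qed

text \<open>The image lies inside the \<open>\<sigma>\<close>-part, so the dense subset is the whole image.\<close>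

lemma omega_Corson_imp_omega_Valdivia:
  fixes X :: "'a topology"
  assumes "omega_Corson X" shows "omega_Valdivia X"
proof -
  from assms obtain I :: "('a \<Rightarrow> real) set" and h where
    h: "embedding_map X (cube I) h" "h ` topspace X \<subseteq> sigma_cube I"
    and X: "compact_space X" "Hausdorff_space X"
    unfolding omega_Corson_def embedding_map_sigma_cube_iff by blast
  have "h ` topspace X \<subseteq> topspace (cube I)"
    using h(1) by (intro continuous_map_image_subset_topspace embedding_map_imp_continuous_map)
  then have "topspace (subtopology (cube I) (h ` topspace X)) = h ` topspace X" by auto
  then have "subtopology (cube I) (h ` topspace X) closure_of (h ` topspace X \<inter> sigma_cube I)
      = h ` topspace X"
    using h(2) closure_of_topspace [of "subtopology (cube I) (h ` topspace X)"]
    by (simp add: Int_absorb2)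
  then show ?thesis using X h(1) by (intro omega_ValdiviaI)
qed

section \<open>The Alexandroff duplicate\<close>

text \<open>A neighbourhood of \<open>(x, False)\<close> covers a whole tube \<open>U \<times> UNIV\<close> except for the single point
  \<open>(x, True)\<close>, so two members of a cover suffice for the tube, and finitely many tubes suffice.\<close>

lemma compact_space_alexandroff_duplicate:
  assumes "compact_space X"
  shows "compact_space (alexandroff_duplicate X)"
  unfolding compact_space_alt
proof (intro allI impI)
  fix \<U> assume A: "(\<forall>U\<in>\<U>. openin (alexandroff_duplicate X) U) \<and>
      topspace (alexandroff_duplicate X) \<subseteq> \<Union>\<U>"
  have "\<exists>W\<in>\<U>. \<exists>W'\<in>\<U>. \<exists>U. openin X U \<and> x \<in> U \<and> U \<times> UNIV \<subseteq> W \<union> W'"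
    if x: "x \<in> topspace X" for x
  proof -
    from A x obtain W W' where W: "W \<in> \<U>" "(x, False) \<in> W" and W': "W' \<in> \<U>" "(x, True) \<in> W'"
      by (auto simp: subset_iff) (metis UnionE)
    from A W obtain U where "openin X U" "x \<in> U" "U \<times> UNIV - {(x, True)} \<subseteq> W"
      unfolding openin_alexandroff_duplicate by blast
    then have "openin X U \<and> x \<in> U \<and> U \<times> UNIV \<subseteq> W \<union> W'" using W' by blast
    with W W' show ?thesis by blast
  qed
  then obtain W W' U where W: "\<And>x. x \<in> topspace X \<Longrightarrow> W x \<in> \<U> \<and> W' x \<in> \<U> \<and> openin X (U x)
      \<and> x \<in> U x \<and> U x \<times> UNIV \<subseteq> W x \<union> W' x"
    by metis
  have "\<exists>\<F>. finite \<F> \<and> \<F> \<subseteq> U ` topspace X \<and> topspace X \<subseteq> \<Union>\<F>"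
    using assms W unfolding compact_space_alt by (elim allE [of _ "U ` topspace X"]) blast
  then obtain F where F: "finite F" "F \<subseteq> topspace X" "topspace X \<subseteq> \<Union>(U ` F)"
    by (metis finite_subset_image)
  show "\<exists>\<F>. finite \<F> \<and> \<F> \<subseteq> \<U> \<and> topspace (alexandroff_duplicate X) \<subseteq> \<Union>\<F>"
  proof (intro exI conjI)
    show "finite (W ` F \<union> W' ` F)" using F by simp
    show "W ` F \<union> W' ` F \<subseteq> \<U>" using F W by blast
    show "topspace (alexandroff_duplicate X) \<subseteq> \<Union>(W ` F \<union> W' ` F)"
    proof
      fix p assume "p \<in> topspace (alexandroff_duplicate X)"
      then obtain x where x: "x \<in> F" "fst p \<in> U x" using F by auto
      then have "p \<in> U x \<times> UNIV" by (cases p) auto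
      then have "p \<in> W x \<union> W' x" using W [of x] x(1) F(2) by auto
      with x(1) show "p \<in> \<Union>(W ` F \<union> W' ` F)" by auto
    qed
  qed
qed

lemma continuous_map_alexandroff_duplicate_fst:
  "continuous_map (alexandroff_duplicate X) X fst"
  unfolding continuous_map_def
proof (intro conjI allI impI)
  fix U assume U: "openin X U"
  have eq: "{p \<in> topspace (alexandroff_duplicate X). fst p \<in> U} = U \<times> UNIV"
    using openin_subset [OF U] by auto
  show "openin (alexandroff_duplicate X) {p \<in> topspace (alexandroff_duplicate X). fst p \<in> U}"
    unfolding eq openin_alexandroff_duplicate
  proof (intro conjI allI impI)
    fix x assume "(x, False) \<in> U \<times> UNIV"
    then show "\<exists>V. openin X V \<and> x \<in> V \<and> V \<times> UNIV - {(x, True)} \<subseteq> U \<times> UNIV"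
      using U by (intro exI [of _ U]) auto
  qed (use openin_subset [OF U] in auto)
qed auto

lemma continuous_map_alexandroff_duplicate_bottom:
  "continuous_map X (alexandroff_duplicate X) (\<lambda>x. (x, False))"
  unfolding continuous_map_def
proof (intro conjI allI impI)
  fix W assume W: "openin (alexandroff_duplicate X) W"
  show "openin X {x \<in> topspace X. (x, False) \<in> W}"
  proof (subst openin_subopen, intro ballI)
    fix x assume x: "x \<in> {x \<in> topspace X. (x, False) \<in> W}"
    then obtain U where "openin X U" "x \<in> U" "U \<times> UNIV - {(x, True)} \<subseteq> W"
      using W unfolding openin_alexandroff_duplicate by blast
    then show "\<exists>T. openin X T \<and> x \<in> T \<and> T \<subseteq> {x \<in> topspace X. (x, False) \<in> W}"
      using openin_subset by (intro exI [of _ U]) blast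
  qed
qed simp

lemma continuous_map_alexandroff_duplicate_indicator:
  assumes "t1_space X" "a \<in> topspace X"
  shows "continuous_map (alexandroff_duplicate X) (top_of_set {0..1::real}) (indicator {(a, True)})"
proof -
  let ?f = "indicator {(a, True)} :: 'a \<times> bool \<Rightarrow> real"
  have o1: "openin (alexandroff_duplicate X) {(a, True)}"
    using assms(2) by (rule openin_alexandroff_duplicate_isolated)
  have o2: "openin (alexandroff_duplicate X) (topspace X \<times> UNIV - {(a, True)})"
    using assms(1) by (intro openin_alexandroff_duplicate_basic) auto
  have "openin (alexandroff_duplicate X) {x \<in> topspace X \<times> UNIV. ?f x \<in> U}" for U :: "real set"
  proof -
    have "{x \<in> topspace X \<times> UNIV. ?f x \<in> U} =
        (if 1 \<in> U then {(a, True)} else {}) \<union> (if 0 \<in> U then topspace X \<times> UNIV - {(a, True)} else {})"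
      using assms(2) by (auto simp: indicator_def)
    moreover have "openin (alexandroff_duplicate X)
        ((if 1 \<in> U then {(a, True)} else {}) \<union>
         (if 0 \<in> U then topspace X \<times> UNIV - {(a, True)} else {}))"
      by (rule openin_Un) (use o1 o2 in simp_all)
    ultimately show ?thesis by simp
  qed
  then have "continuous_map (alexandroff_duplicate X) euclideanreal ?f"
    by (simp add: continuous_map_def del: indicator_simps)
  then show ?thesis
    by (simp add: continuous_map_unit_interval indicator_def)
qed

text \<open>The pulled-back functions distinguish different first coordinates, and the indicator of
  \<open>(x, True)\<close> distinguishes the two points over \<open>x\<close>.\<close>

lemma omega_Corson_alexandroff_duplicate:
  fixes X :: "'a topology"
  assumes "omega_Corson X"
  shows "omega_Corson (alexandroff_duplicate X)"
proof -
  from assms obtain I :: "('a \<Rightarrow> real) set" and f where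
    f: "separating_family X I f" "point_finite X I f"
    by (rule omega_Corson_imp_separating_family)
  have X: "compact_space X" "t1_space X"
    using assms by (auto simp: omega_Corson_def Hausdorff_imp_t1_space)
  define g :: "('a \<Rightarrow> real) + 'a \<Rightarrow> 'a \<times> bool \<Rightarrow> real" where
    "g = case_sum (\<lambda>i. f i \<circ> fst) (\<lambda>a. indicator {(a, True)})"
  let ?J = "Inl ` I \<union> Inr ` topspace X"
  have "separating_family (alexandroff_duplicate X) ?J g"
  proof (rule separating_familyI)
    fix j assume "j \<in> ?J"
    then show "continuous_map (alexandroff_duplicate X) (top_of_set {0..1}) (g j)"
      using f(1) X(2)
      by (auto simp: g_def separating_family_def
          intro!: continuous_map_compose [OF continuous_map_alexandroff_duplicate_fst]
            continuous_map_alexandroff_duplicate_indicator)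
  next
    fix p q
    assume p: "p \<in> topspace (alexandroff_duplicate X)" and q: "q \<in> topspace (alexandroff_duplicate X)"
      and e: "\<And>j. j \<in> ?J \<Longrightarrow> g j p = g j q"
    have "f i (fst p) = f i (fst q)" if "i \<in> I" for i
      using e [of "Inl i"] that by (simp add: g_def)
    then have 1: "fst p = fst q"
      using p q by (intro separating_family_eqI [OF f(1)]) auto
    have "indicator {(fst p, True)} p = (indicator {(fst p, True)} q :: real)"
      using e [of "Inr (fst p)"] p by (auto simp: g_def)
    with 1 show "p = q" by (cases p; cases q) (auto simp: indicator_def split: if_splits)
  qed
  moreover have "point_finite (alexandroff_duplicate X) ?J g"
    unfolding point_finite_def
  proof
    fix p assume p: "p \<in> topspace (alexandroff_duplicate X)"
    have "{j \<in> ?J. g j p \<noteq> 0} \<subseteq> Inl ` {i \<in> I. f i (fst p) \<noteq> 0} \<union> {Inr (fst p)}"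
      by (auto simp: g_def indicator_def split: if_splits)
    moreover have "finite (Inl ` {i \<in> I. f i (fst p) \<noteq> 0} \<union> {Inr (fst p)})"
      using f(2) p by (auto simp: point_finite_def)
    ultimately show "finite {j \<in> ?J. g j p \<noteq> 0}"
      by (rule finite_subset)
  qed
  ultimately show ?thesis
    using compact_space_alexandroff_duplicate [OF X(1)] by (intro separating_family_imp_omega_Corson)
qed

text \<open>Continuity at \<open>(x, False)\<close> makes the jump smaller than \<open>e\<close> over a punctured neighbourhood of
  \<open>x\<close>, so only the centres of a finite subcover can have a large jump.\<close>

lemma finite_jump_alexandroff_duplicate:
  fixes f :: "'a \<times> bool \<Rightarrow> real"
  assumes X: "compact_space X" and f: "continuous_map (alexandroff_duplicate X) euclideanreal f"
    and e: "e > 0"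
  shows "finite {x \<in> topspace X. \<bar>f (x, False) - f (x, True)\<bar> \<ge> e}"
proof -
  have "\<exists>U. openin X U \<and> x \<in> U \<and> (\<forall>y\<in>U - {x}. \<bar>f (y, False) - f (y, True)\<bar> < e)"
    if x: "x \<in> topspace X" for x
  proof -
    let ?W = "{p \<in> topspace X \<times> UNIV. f p \<in> ball (f (x, False)) (e/2)}"
    have "openin (alexandroff_duplicate X) ?W"
      using f unfolding continuous_map_def topspace_alexandroff_duplicate open_openin [symmetric]
      by (metis open_ball)
    moreover have "(x, False) \<in> ?W" using x e by simp
    ultimately obtain U where U: "openin X U" "x \<in> U" "U \<times> UNIV - {(x, True)} \<subseteq> ?W"
      unfolding openin_alexandroff_duplicate by blast
    have "\<bar>f (y, False) - f (y, True)\<bar> < e" if y: "y \<in> U - {x}" for y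
    proof -
      have "(y, False) \<in> ?W" "(y, True) \<in> ?W" using U(3) y by blast+
      then have "\<bar>f (x, False) - f (y, False)\<bar> < e/2" "\<bar>f (x, False) - f (y, True)\<bar> < e/2"
        by (auto simp: dist_real_def)
      then show ?thesis by linarith
    qed
    with U show ?thesis by blast
  qed
  then obtain U where U: "\<And>x. x \<in> topspace X \<Longrightarrow> openin X (U x) \<and> x \<in> U x
      \<and> (\<forall>y\<in>U x - {x}. \<bar>f (y, False) - f (y, True)\<bar> < e)"
    by metis
  have "\<exists>\<F>. finite \<F> \<and> \<F> \<subseteq> U ` topspace X \<and> topspace X \<subseteq> \<Union>\<F>"
    using X U unfolding compact_space_alt by (elim allE [of _ "U ` topspace X"]) blast
  then obtain F where F: "finite F" "F \<subseteq> topspace X" "topspace X \<subseteq> \<Union>(U ` F)"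
    by (metis finite_subset_image)
  have "{x \<in> topspace X. \<bar>f (x, False) - f (x, True)\<bar> \<ge> e} \<subseteq> F"
  proof
    fix x assume x: "x \<in> {x \<in> topspace X. \<bar>f (x, False) - f (x, True)\<bar> \<ge> e}"
    then obtain y where y: "y \<in> F" "x \<in> U y" using F by auto
    show "x \<in> F"
    proof (rule ccontr)
      assume "x \<notin> F"
      with y have "x \<in> U y - {y}" by blast
      moreover have "y \<in> topspace X" using y(1) F(2) by blast
      ultimately have "\<bar>f (x, False) - f (x, True)\<bar> < e" using U by blast
      with x show False by simp
    qed
  qed
  then show ?thesis using F(1) by (rule finite_subset)
qed

text \<open>The image of an isolated point is open in the image of the duplicate, hence meets, and so lies
  in, the dense \<open>\<sigma>\<close>-part.\<close>

lemma omega_Valdivia_alexandroff_duplicate_imp: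
  fixes X :: "'a topology"
  assumes "omega_Valdivia (alexandroff_duplicate X)"
  obtains I :: "('a \<times> bool \<Rightarrow> real) set" and f
  where "separating_family (alexandroff_duplicate X) I f"
    "\<forall>x\<in>topspace X. finite {i\<in>I. f i (x, True) \<noteq> 0}"
proof -
  let ?D = "alexandroff_duplicate X"
  from assms obtain I :: "('a \<times> bool \<Rightarrow> real) set" and h where
    h: "embedding_map ?D (cube I) h" and
    dense: "subtopology (cube I) (h ` topspace ?D) closure_of (h ` topspace ?D \<inter> sigma_cube I)
          = h ` topspace ?D"
    unfolding omega_Valdivia_def by metis
  have "finite {i\<in>I. h (x, True) i \<noteq> 0}" if x: "x \<in> topspace X" for x
  proof -
    let ?Y = "subtopology (cube I) (h ` topspace ?D)"
    have "open_map ?D ?Y h"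
      using h unfolding embedding_map_def by (rule homeomorphic_imp_open_map)
    then have "openin ?Y (h ` {(x, True)})"
      using openin_alexandroff_duplicate_isolated [OF x] by (simp only: open_map_def)
    moreover have "h (x, True) \<in> ?Y closure_of (h ` topspace ?D \<inter> sigma_cube I)"
      unfolding dense using x by simp
    ultimately have "\<exists>p. p \<in> h ` topspace ?D \<inter> sigma_cube I \<and> p \<in> h ` {(x, True)}"
      unfolding in_closure_of by (elim conjE allE [of _ "h ` {(x, True)}"]) simp
    then have "h (x, True) \<in> sigma_cube I" by auto
    then show ?thesis by (simp add: sigma_cube_def)
  qed
  then have "\<forall>x\<in>topspace X. finite {i\<in>I. h (x, True) i \<noteq> 0}" by (rule ballI)
  then show thesis by (rule that [OF embedding_cube_imp_separating_family [OF h]])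
qed



section \<open>Cutting the unit interval into levels\<close>

text \<open>A tent over the interval \<open>(1/(n+2), 1/n)\<close>, or for \<open>n = 0\<close> a ramp that rises on \<open>[1/2, 1]\<close>. Near
  every \<open>a > 0\<close> only finitely many of them are nonzero, so composing with all of them splits a
  function into pieces without spoiling point-finiteness; the \<open>n\<close>-th piece lives where the function
  exceeds \<open>1/(n+2)\<close>.\<close>

definition tent :: "nat \<Rightarrow> real \<Rightarrow> real" where
  "tent n a = max 0 (min ((real n + 2) * a - 1) (1 - real n * a))"

lemma tent_0 [simp]: "tent n 0 = 0"
  by (simp add: tent_def)

lemma tent_bounds: "0 \<le> tent n a" "0 \<le> a \<Longrightarrow> tent n a \<le> 1"
  by (auto simp: tent_def min_le_iff_disj)

lemma tent_neq_0_iff: "tent n a \<noteq> 0 \<longleftrightarrow> 1 < (real n + 2) * a \<and> real n * a < 1"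
  by (auto simp: tent_def)

lemma continuous_map_tent:
  "continuous_map X euclideanreal f \<Longrightarrow> continuous_map X euclideanreal (\<lambda>x. tent n (f x))"
  unfolding tent_def by (intro continuous_intros) auto

lemma finite_tent: "finite {n. tent n a \<noteq> 0}"
proof (cases "a > 0")
  case True
  have "{n. tent n a \<noteq> 0} \<subseteq> {..nat \<lceil>1/a\<rceil>}"
  proof
    fix n assume "n \<in> {n. tent n a \<noteq> 0}"
    then have "real n < 1/a" using True by (simp add: tent_neq_0_iff field_simps)
    then show "n \<in> {..nat \<lceil>1/a\<rceil>}" by (simp, linarith)
  qed
  then show ?thesis by (rule finite_subset) simp
next
  case False
  then have "(real n + 2) * a \<le> 0" for n by (simp add: mult_nonneg_nonpos)
  then have "{n. tent n a \<noteq> 0} = {}" by (auto simp: tent_neq_0_iff) (metis less_le_not_le order_less_le_trans zero_less_one)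
  then show ?thesis by simp
qed

lemma ex_tent_level:
  assumes "0 < a"
  obtains n where "real n * a < 1" "1 \<le> (real n + 1) * a"
proof -
  define n where "n = nat (\<lceil>1/a\<rceil> - 1)"
  have "0 < \<lceil>1/a\<rceil>" using assms by simp
  then have n: "real n = real_of_int \<lceil>1/a\<rceil> - 1"
    unfolding n_def by simp
  have "real n < 1/a" "1/a \<le> real n + 1" unfolding n by linarith+
  then show thesis using assms by (intro that) (auto simp: field_simps)
qed

lemma tent_neq_0_ex:
  assumes "0 < a"
  obtains n where "tent n a \<noteq> 0"
proof -
  obtain n where "real n * a < 1" "1 \<le> (real n + 1) * a"
    using assms by (rule ex_tent_level)
  then have "tent n a \<noteq> 0" using assms by (simp add: tent_neq_0_iff algebra_simps)
  then show thesis by (rule that)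
qed

text \<open>For \<open>a > 0\<close> choose \<open>n\<close> with \<open>1/(n+1) \<le> a\<close> and \<open>n * a < 1\<close>. Then \<open>n > 0\<close> because \<open>a < 1\<close>, and \<open>a\<close>
  lies on the descending side of the \<open>n\<close>-th tent, whose value at any \<open>b > a\<close> is smaller.\<close>

lemma tent_separates:
  assumes "0 \<le> a" "a < b" "b \<le> 1"
  obtains n where "tent n a \<noteq> tent n b"
proof (cases "a = 0")
  case True
  with assms obtain n where "tent n b \<noteq> 0" using tent_neq_0_ex by auto
  with True show thesis by (intro that [of n]) simp
next
  case False
  with assms obtain n where n: "real n * a < 1" "1 \<le> (real n + 1) * a"
    using ex_tent_level [of a] by auto
  have "n \<noteq> 0" using n(2) assms by (intro notI) simp
  then have "real n * a < real n * b" using assms by simp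
  moreover have "1 - real n * a \<le> (real n + 2) * a - 1"
    using n(2) by (simp add: algebra_simps)
  ultimately have "tent n b < tent n a"
    using n(1) by (auto simp: tent_def)
  then show thesis by (intro that [of n]) simp
qed

lemma tent_eqD:
  assumes "\<And>n. tent n a = tent n b" "0 \<le> a" "a \<le> 1" "0 \<le> b" "b \<le> 1"
  shows "a = b"
  using tent_separates [of a b] tent_separates [of b a] assms by (metis linorder_neqE_linordered_idom)

section \<open>Peak functions and the removal of exceptional points\<close>

lemma continuous_map_suminf:
  fixes u :: "nat \<Rightarrow> 'a \<Rightarrow> real"
  assumes "\<And>n. continuous_map X euclideanreal (u n)"
    and "\<And>n x. x \<in> topspace X \<Longrightarrow> \<bar>u n x\<bar> \<le> M n" and "summable M"
  shows "continuous_map X euclideanreal (\<lambda>x. \<Sum>n. u n x)"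
proof -
  have "uniform_limit (topspace X) (\<lambda>n x. \<Sum>i<n. u i x) (\<lambda>x. \<Sum>n. u n x) sequentially"
    using assms by (intro Weierstrass_m_test [where M = M]) auto
  then have "continuous_map X Met_TC.mtopology (\<lambda>x. \<Sum>n. u n x)"
    using assms(1)
    by (intro Met_TC.continuous_map_uniform_limit
          [where F = sequentially and f = "\<lambda>n x. \<Sum>i<n. u i x"])
      (auto simp: uniform_limit_iff intro!: always_eventually continuous_map_sum)
  then show ?thesis by simp
qed

text \<open>Adjoining to \<open>J\<close> one separating index for every other point of the fibre keeps it countable and
  shrinks the fibre to \<open>{c}\<close>; a weighted sum of the distances \<open>\<bar>f i x - f i c\<bar>\<close> over the enlarged
  index set then vanishes at \<open>c\<close> only.\<close>

lemma point_zero_set_of_countable: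
  assumes f: "separating_family X I f" and c: "c \<in> topspace X"
    and J: "J \<subseteq> I" "countable J"
    and fibre: "countable {x \<in> topspace X. \<forall>i\<in>J. f i x = f i c}"
  obtains z where "continuous_map X euclideanreal z"
    "\<And>x. x \<in> topspace X \<Longrightarrow> 0 \<le> z x" "\<And>x. x \<in> topspace X \<Longrightarrow> z x = 0 \<longleftrightarrow> x = c"
proof -
  let ?A = "{x \<in> topspace X. \<forall>i\<in>J. f i x = f i c} - {c}"
  have "\<forall>y\<in>?A. \<exists>i. i \<in> I \<and> f i y \<noteq> f i c"
    using separating_family_eqI [OF f _ c] by fast
  then obtain k where k: "\<forall>y\<in>?A. k y \<in> I \<and> f (k y) y \<noteq> f (k y) c"
    by (rule bchoice [THEN exE])
  define L where "L = J \<union> k ` ?A"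
  have "k ` ?A \<subseteq> I" using k by (simp add: image_subset_iff)
  then have L: "L \<subseteq> I" "countable L"
    using J fibre by (simp_all add: L_def)
  have sep: "x = c" if x: "x \<in> topspace X" "\<And>i. i \<in> L \<Longrightarrow> f i x = f i c" for x
  proof (rule ccontr)
    assume "x \<noteq> c"
    then have A: "x \<in> ?A" using x by (simp add: L_def)
    then have "k x \<in> L" by (simp add: L_def)
    then show False using k [THEN bspec, OF A] x(2) by simp
  qed
  show thesis
  proof (cases "L = {}")
    case True
    then have "x = c" if "x \<in> topspace X" for x using sep that by auto
    then show thesis by (intro that [of "\<lambda>_. 0"]) auto
  next
    case False
    define l where "l = from_nat_into L"
    have l: "range l = L" unfolding l_def using False L(2) by (rule range_from_nat_into)
    then have lI: "l n \<in> I" for n using L(1) by auto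
    define u where "u n x = (1/2)^n * \<bar>f (l n) x - f (l n) c\<bar>" for n x
    have bound: "\<bar>u n x\<bar> \<le> (1/2)^n" if "x \<in> topspace X" for n x
      using separating_family_bounds [OF f lI that, of n] separating_family_bounds [OF f lI c, of n]
      by (simp add: u_def abs_mult mult_le_cancel_left1)
    have summable: "summable (\<lambda>n. u n x)" if "x \<in> topspace X" for x
      using bound [OF that] by (intro summable_comparison_test' [OF summable_geometric, of "1/2" 0]) auto
    have "continuous_map X euclideanreal (u n)" for n
      unfolding u_def using separating_family_continuous [OF f lI]
      by (intro continuous_intros) auto
    then have cont: "continuous_map X euclideanreal (\<lambda>x. \<Sum>n. u n x)"
      by (rule continuous_map_suminf [OF _ bound summable_geometric]) auto
    show thesis
    proof (rule that [OF cont])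
      fix x assume x: "x \<in> topspace X"
      show "0 \<le> (\<Sum>n. u n x)"
        using summable [OF x] by (rule suminf_nonneg) (simp add: u_def)
      have "(\<Sum>n. u n x) = 0 \<longleftrightarrow> (\<forall>n. u n x = 0)"
        using summable [OF x] by (rule suminf_eq_zero_iff) (simp add: u_def)
      also have "\<dots> \<longleftrightarrow> (\<forall>i\<in>L. f i x = f i c)"
        unfolding l [symmetric] by (simp add: u_def)
      also have "\<dots> \<longleftrightarrow> x = c"
        using sep [OF x] by auto
      finally show "(\<Sum>n. u n x) = 0 \<longleftrightarrow> x = c" .
    qed
  qed
qed

text \<open>Take a countably infinite set of members that are nonzero at \<open>c\<close>. A point where all of them have the same
  value as at \<open>c\<close> is an exception of some (indeed, of almost every) one of them, and the exceptions of
  countably many members form a countable set. Hence \<open>c\<close> is the zero set of a continuous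
  function, which is turned upside down and rescaled.

  The last property is what makes peak functions at different points point-finite: every \<open>x \<noteq> c\<close> in
  the support of \<open>v\<close> is a point where the member \<open>i\<close> is nonzero but \<open>x\<close> is not an exception of it.
  That leaves finitely many \<open>i\<close>, and \<open>c\<close> is one of the finitely many exceptions of such an \<open>i\<close>.\<close>

lemma peak_function_at_exceptional_point:
  fixes f :: "'i \<Rightarrow> 'a \<Rightarrow> real"
  assumes f: "separating_family X I f"
    and C: "\<And>i. i \<in> I \<Longrightarrow> finite (C i)"
    and fin: "\<And>x. x \<in> topspace X \<Longrightarrow> finite {i\<in>I. f i x \<noteq> 0 \<and> x \<notin> C i}"
    and cX: "c \<in> topspace X" and inf: "infinite {i\<in>I. f i c \<noteq> 0 \<and> c \<in> C i}"
  obtains i v where "i \<in> I" "c \<in> C i" "continuous_map X (top_of_set {0..1::real}) v"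
    "\<And>x. x \<in> topspace X \<Longrightarrow> v x = 1 \<longleftrightarrow> x = c"
    "\<And>x. x \<in> topspace X \<Longrightarrow> v x \<noteq> 0 \<Longrightarrow> f i x \<noteq> 0 \<and> x \<notin> C i - {c}"
proof -
  obtain T where T: "infinite T" "countable T" "T \<subseteq> {i\<in>I. f i c \<noteq> 0 \<and> c \<in> C i}"
    using infinite_countable_subset' [OF inf] by auto
  from T obtain i where i: "i \<in> T" by (metis finite.emptyI equals0I)
  then have iI: "i \<in> I" "f i c \<noteq> 0" "c \<in> C i" using T by auto
  have "{x \<in> topspace X. \<forall>i\<in>T. f i x = f i c} \<subseteq> (\<Union>i\<in>T. C i)"
  proof
    fix x assume x: "x \<in> {x \<in> topspace X. \<forall>i\<in>T. f i x = f i c}"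
    have "\<not> T \<subseteq> {i\<in>I. f i x \<noteq> 0 \<and> x \<notin> C i}"
      using T(1) finite_subset [OF _ fin [of x]] x by auto
    then obtain j where j: "j \<in> T" "\<not> (j \<in> I \<and> f j x \<noteq> 0 \<and> x \<notin> C j)" by blast
    moreover have "f j x = f j c" "f j c \<noteq> 0" "j \<in> I" using x T(3) j(1) by auto
    ultimately show "x \<in> (\<Union>i\<in>T. C i)" by auto
  qed
  moreover have "countable (\<Union>i\<in>T. C i)"
    using T C by (intro countable_UN) (auto intro: countable_finite)
  ultimately have "countable {x \<in> topspace X. \<forall>i\<in>T. f i x = f i c}"
    by (rule countable_subset)
  then obtain z0 where z0: "continuous_map X euclideanreal z0"
    "\<And>x. x \<in> topspace X \<Longrightarrow> 0 \<le> z0 x" "\<And>x. x \<in> topspace X \<Longrightarrow> z0 x = 0 \<longleftrightarrow> x = c"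
    using T(3) by (rule_tac point_zero_set_of_countable [OF f cX _ T(2)]) auto
  \<comment> \<open>The summand \<open>\<bar>f i x - f i c\<bar>\<close> forces \<open>z \<ge> f i c\<close> wherever \<open>f i\<close> vanishes.\<close>
  define z where "z x = z0 x + \<bar>f i x - f i c\<bar>" for x
  have z: "continuous_map X euclideanreal z"
    unfolding z_def using z0(1) separating_family_continuous [OF f iI(1)]
    by (intro continuous_intros) auto
  have zpos: "0 < z x" if "x \<in> topspace X" "x \<noteq> c" for x
    using z0(2,3) [OF that(1)] that(2) unfolding z_def by (smt (verit))
  have zc: "z c = 0" using z0(3) [OF cX] by (simp add: z_def)
  \<comment> \<open>Where \<open>z < e\<close> there are neither zeros of \<open>f i\<close> nor exceptions of \<open>i\<close> other than \<open>c\<close>.\<close>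
  define e where "e = Min (insert (f i c) (z ` (topspace X \<inter> C i - {c})))"
  have finE: "finite (insert (f i c) (z ` (topspace X \<inter> C i - {c})))"
    using C [OF iI(1)] by simp
  have e: "0 < e"
    unfolding e_def using finE zpos separating_family_bounds(1) [OF f iI(1) cX] iI(2)
    by (subst Min_gr_iff) auto
  have e1: "e \<le> f i c" and e2: "\<And>x. x \<in> topspace X \<Longrightarrow> x \<in> C i - {c} \<Longrightarrow> e \<le> z x"
    unfolding e_def using finE by (auto intro: Min_le)
  define v where "v x = max 0 (1 - (1/e) * z x)" for x
  have "continuous_map X euclideanreal v"
    unfolding v_def using z by (intro continuous_intros) auto
  moreover have "0 \<le> z x" if "x \<in> topspace X" for x
    using z0(2) [OF that] by (simp add: z_def)
  ultimately have "continuous_map X (top_of_set {0..1::real}) v"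
    using e by (auto simp: continuous_map_unit_interval v_def)
  moreover have "v x = 1 \<longleftrightarrow> x = c" if "x \<in> topspace X" for x
    using zpos [OF that] zc e by (cases "x = c") (auto simp: v_def max_def)
  moreover have "f i x \<noteq> 0 \<and> x \<notin> C i - {c}" if x: "x \<in> topspace X" and "v x \<noteq> 0" for x
  proof -
    have "z x < e" using that(2) e by (auto simp: v_def max_def field_simps split: if_splits)
    moreover from this have "f i x \<noteq> 0"
      using z0(2) [OF x] e1 by (auto simp: z_def)
    moreover have "x \<notin> C i - {c}"
    proof
      assume "x \<in> C i - {c}"
      with e2 [OF x] have "e \<le> z x" by blast
      with \<open>z x < e\<close> show False by simp
    qed
    ultimately show ?thesis by blast
  qed
  ultimately show thesis by (rule that [OF iI(1,3)])
qed

text \<open>The peak functions take over the separation of the points of \<open>B\<close>, so that every old member may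
  be made to vanish at those of its exceptions that lie in \<open>B\<close>. The summands of the index type
  number the peak functions and the pieces of the old members.\<close>

lemma point_finite_separating_family_of_exceptions:
  fixes f :: "'i \<Rightarrow> 'a \<Rightarrow> real"
  assumes f: "separating_family X I f"
    and C: "\<And>i. i \<in> I \<Longrightarrow> finite (C i)"
    and fin: "\<And>x. x \<in> topspace X \<Longrightarrow> finite {i\<in>I. f i x \<noteq> 0 \<and> x \<notin> C i}"
  obtains J :: "('a + 'i \<times> nat) set" and g where "separating_family X J g" "point_finite X J g"
proof -
  define N where "N x = {i\<in>I. f i x \<noteq> 0 \<and> x \<notin> C i}" for x
  define B where "B = {x \<in> topspace X. infinite {i\<in>I. f i x \<noteq> 0}}"
  have inf: "infinite {i\<in>I. f i c \<noteq> 0 \<and> c \<in> C i}" if "c \<in> B" for c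
  proof
    assume "finite {i\<in>I. f i c \<noteq> 0 \<and> c \<in> C i}"
    then have "finite ({i\<in>I. f i c \<noteq> 0 \<and> c \<in> C i} \<union> N c)"
      using fin [of c] that by (simp add: B_def N_def)
    moreover have "{i\<in>I. f i c \<noteq> 0 \<and> c \<in> C i} \<union> N c = {i\<in>I. f i c \<noteq> 0}"
      by (auto simp: N_def)
    ultimately show False using that by (simp add: B_def)
  qed
  have "\<exists>i v. i \<in> I \<and> c \<in> C i \<and> continuous_map X (top_of_set {0..1::real}) v \<and>
      (\<forall>x\<in>topspace X. v x = 1 \<longleftrightarrow> x = c) \<and>
      (\<forall>x\<in>topspace X. v x \<noteq> 0 \<longrightarrow> f i x \<noteq> 0 \<and> x \<notin> C i - {c})" (is "\<exists>i v. ?P c i v")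
    if c: "c \<in> B" for c
  proof -
    from c have "c \<in> topspace X" by (simp add: B_def)
    from peak_function_at_exceptional_point [OF f C fin this inf [OF c]]
    obtain i v where "i \<in> I" "c \<in> C i" "continuous_map X (top_of_set {0..1::real}) v"
      "\<And>x. x \<in> topspace X \<Longrightarrow> v x = 1 \<longleftrightarrow> x = c"
      "\<And>x. x \<in> topspace X \<Longrightarrow> v x \<noteq> 0 \<Longrightarrow> f i x \<noteq> 0 \<and> x \<notin> C i - {c}"
      by metis
    then have "?P c i v" by simp
    then show ?thesis by (intro exI)
  qed
  then have "\<forall>c\<in>B. \<exists>i v. ?P c i v" by (rule ballI)
  then obtain k where "\<forall>c\<in>B. \<exists>v. ?P c (k c) v" by (rule bchoice [THEN exE])
  then obtain v where kv: "\<forall>c\<in>B. ?P c (k c) (v c)" by (rule bchoice [THEN exE])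
  have kI: "k c \<in> I" and kC: "c \<in> C (k c)"
    and v_cont: "continuous_map X (top_of_set {0..1::real}) (v c)"
    and v_1: "\<And>x. x \<in> topspace X \<Longrightarrow> v c x = 1 \<longleftrightarrow> x = c"
    and v_supp: "\<And>x. x \<in> topspace X \<Longrightarrow> v c x \<noteq> 0 \<Longrightarrow> f (k c) x \<noteq> 0 \<and> x \<notin> C (k c) - {c}"
    if "c \<in> B" for c
    using kv [THEN bspec, OF that] by simp_all
  have v_fin: "finite {c \<in> B. v c x \<noteq> 0}" if x: "x \<in> topspace X" for x
  proof (rule finite_subset)
    show "{c \<in> B. v c x \<noteq> 0} \<subseteq> insert x (\<Union>i\<in>N x. C i)"
    proof
      fix c assume c: "c \<in> {c \<in> B. v c x \<noteq> 0}"
      then have kc: "k c \<in> I" "c \<in> C (k c)" "f (k c) x \<noteq> 0" "x \<notin> C (k c) - {c}"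
        using kI [of c] kC [of c] v_supp [of c x] x by auto
      show "c \<in> insert x (\<Union>i\<in>N x. C i)"
      proof (cases "c = x")
        case False
        with kc have "k c \<in> N x" by (auto simp: N_def)
        with kc(2) show ?thesis by auto
      qed simp
    qed
    have "finite (N x)" using fin [OF x] by (simp add: N_def)
    moreover have "finite (C i)" if "i \<in> N x" for i using C that by (simp add: N_def)
    ultimately show "finite (insert x (\<Union>i\<in>N x. C i))" by simp
  qed
  \<comment> \<open>Zero exactly on \<open>C i \<inter> B\<close>, since \<open>v c\<close> takes the value \<open>1\<close> only at \<open>c\<close>.\<close>
  define d where "d i x = (\<Prod>c\<in>C i \<inter> B. 1 - v c x)" for i x
  have v01: "0 \<le> v c x \<and> v c x \<le> 1" if "c \<in> B" "x \<in> topspace X" for c x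
    using v_cont [OF that(1)] that(2) by (simp add: continuous_map_unit_interval)
  have d01: "0 \<le> d i x" "d i x \<le> 1" if "x \<in> topspace X" for i x
    unfolding d_def using v01 that by (auto intro!: prod_nonneg prod_le_1)
  have d_cont: "continuous_map X euclideanreal (d i)" if "i \<in> I" for i
    unfolding d_def using v_cont C [OF that]
    by (intro continuous_intros) (auto simp: continuous_map_unit_interval)
  have d_zero: "d i x = 0 \<longleftrightarrow> x \<in> C i \<inter> B" if "i \<in> I" "x \<in> topspace X" for i x
  proof -
    have "d i x = 0 \<longleftrightarrow> (\<exists>c\<in>C i \<inter> B. v c x = 1)"
      unfolding d_def using C [OF that(1)] by (subst prod_zero_iff) auto
    also have "\<dots> \<longleftrightarrow> x \<in> C i \<inter> B" using v_1 [OF _ that(2)] by auto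
    finally show ?thesis .
  qed
  define g :: "'a + 'i \<times> nat \<Rightarrow> 'a \<Rightarrow> real" where
    "g = case_sum v (\<lambda>(i, n) x. f i x * tent n (d i x))"
  let ?J = "Inl ` B \<union> Inr ` (I \<times> UNIV) :: ('a + 'i \<times> nat) set"
  have "separating_family X ?J g"
  proof (rule separating_familyI)
    fix j assume "j \<in> ?J"
    then consider c where "c \<in> B" "j = Inl c" | i n where "i \<in> I" "j = Inr (i, n)" by auto
    then show "continuous_map X (top_of_set {0..1}) (g j)"
    proof cases
      case 1
      then show ?thesis using v_cont by (simp add: g_def)
    next
      case 2
      have "continuous_map X euclideanreal (\<lambda>x. f i x * tent n (d i x))"
        using separating_family_continuous [OF f] d_cont 2(1)
        by (intro continuous_intros continuous_map_tent) auto
      moreover have "0 \<le> f i x * tent n (d i x) \<and> f i x * tent n (d i x) \<le> 1"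
        if "x \<in> topspace X" for x
        using separating_family_bounds [OF f 2(1) that] tent_bounds d01 [OF that]
        by (simp add: mult_le_one)
      ultimately show ?thesis using 2 by (simp add: g_def continuous_map_unit_interval)
    qed
  next
    fix x y assume x: "x \<in> topspace X" and y: "y \<in> topspace X"
      and e: "\<And>j. j \<in> ?J \<Longrightarrow> g j x = g j y"
    have ev: "v c x = v c y" if "c \<in> B" for c
      using e [of "Inl c"] that by (simp add: g_def)
    show "x = y"
    proof (cases "x \<in> B \<or> y \<in> B")
      case True
      then show ?thesis
      proof
        assume "x \<in> B"
        with x have "v x x = 1" by (simp only: v_1)
        with ev [OF \<open>x \<in> B\<close>] have "v x y = 1" by (simp only:)
        with v_1 [OF \<open>x \<in> B\<close> y] show ?thesis by simp
      next
        assume "y \<in> B"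
        with y have "v y y = 1" by (simp only: v_1)
        with ev [OF \<open>y \<in> B\<close>] have "v y x = 1" by (simp only:)
        with v_1 [OF \<open>y \<in> B\<close> x] show ?thesis by simp
      qed
    next
      case False
      have "f i x = f i y" if i: "i \<in> I" for i
      proof -
        \<comment> \<open>\<open>d i\<close> is determined by the peak functions, so its pieces cancel.\<close>
        have dd: "d i x = d i y" unfolding d_def using ev by (intro prod.cong) auto
        have "0 < d i x"
          using d_zero [OF i x] d01(1) [OF x, of i] False by (simp add: less_le)
        then obtain n where n: "tent n (d i x) \<noteq> 0" by (rule tent_neq_0_ex)
        have "f i x * tent n (d i x) = f i y * tent n (d i y)"
          using e [of "Inr (i, n)"] i by (simp add: g_def)
        with n dd show ?thesis by simp
      qed
      then show ?thesis using x y by (intro separating_family_eqI [OF f])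
    qed
  qed
  moreover have "point_finite X ?J g"
    unfolding point_finite_def
  proof
    fix x assume x: "x \<in> topspace X"
    \<comment> \<open>The members with a nonzero piece at \<open>x\<close>: off \<open>B\<close> the old family is point-finite, and at
      points of \<open>B\<close> only the members for which \<open>x\<close> is no exception survive.\<close>
    define S where "S = {i\<in>I. f i x \<noteq> 0 \<and> x \<notin> C i \<inter> B}"
    have "finite S"
    proof (cases "x \<in> B")
      case True
      then show ?thesis using fin [OF x] by (simp add: S_def)
    next
      case False
      then show ?thesis using x by (simp add: S_def B_def)
    qed
    moreover have "{j \<in> ?J. g j x \<noteq> 0} \<subseteq> Inl ` {c \<in> B. v c x \<noteq> 0}
        \<union> Inr ` (SIGMA i:S. {n. tent n (d i x) \<noteq> 0})"
    proof
      fix j assume j: "j \<in> {j \<in> ?J. g j x \<noteq> 0}"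
      show "j \<in> Inl ` {c \<in> B. v c x \<noteq> 0} \<union> Inr ` (SIGMA i:S. {n. tent n (d i x) \<noteq> 0})"
      proof (cases j)
        case (Inl c)
        then show ?thesis using j by (auto simp: g_def)
      next
        case (Inr p)
        obtain i n where p: "p = (i, n)" by fastforce
        with Inr j have i: "i \<in> I" "f i x \<noteq> 0" "tent n (d i x) \<noteq> 0" by (auto simp: g_def)
        then have "d i x \<noteq> 0" by auto
        with i have "i \<in> S" using d_zero [OF i(1) x] by (simp add: S_def)
        then show ?thesis using i Inr p by auto
      qed
    qed
    moreover have "finite (SIGMA i:S. {n. tent n (d i x) \<noteq> 0})"
      using \<open>finite S\<close> finite_tent by (intro finite_SigmaI)
    then have "finite (Inl ` {c \<in> B. v c x \<noteq> 0} \<union> Inr ` (SIGMA i:S. {n. tent n (d i x) \<noteq> 0}))"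
      using v_fin [OF x] by simp
    ultimately show "finite {j \<in> ?J. g j x \<noteq> 0}" by (elim finite_subset)
  qed
  ultimately show thesis by (rule that)
qed

section \<open>Descent from the duplicate\<close>

text \<open>The exceptions of the \<open>n\<close>-th piece of \<open>f i\<close> are the points \<open>x\<close> where it is nonzero on the bottom
  level although \<open>f i\<close> vanishes at \<open>(x, True)\<close>. There \<open>f i\<close> has a jump of size at least
  \<open>1/(n+2)\<close>, so they are finite in number.\<close>

lemma omega_Valdivia_alexandroff_duplicate_imp_omega_Corson:
  fixes X :: "'a topology"
  assumes X: "compact_space X" and V: "omega_Valdivia (alexandroff_duplicate X)"
  shows "omega_Corson X"
proof -
  let ?D = "alexandroff_duplicate X"
  obtain I :: "('a \<times> bool \<Rightarrow> real) set" and f where f: "separating_family ?D I f"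
    and fin: "\<forall>x\<in>topspace X. finite {i\<in>I. f i (x, True) \<noteq> 0}"
    using V by (rule omega_Valdivia_alexandroff_duplicate_imp)
  define g where "g = (\<lambda>(i, n) x. tent n (f i (x, False)))"
  define C where "C = (\<lambda>(i, n). {x \<in> topspace X. tent n (f i (x, False)) \<noteq> 0 \<and> f i (x, True) = 0})"
  let ?J = "I \<times> (UNIV :: nat set)"
  have f01: "0 \<le> f i p" "f i p \<le> 1" if "i \<in> I" "p \<in> topspace X \<times> UNIV" for i p
    using separating_family_bounds [OF f that(1)] that(2) by auto
  have "separating_family X ?J g"
  proof (rule separating_familyI)
    fix j assume "j \<in> ?J"
    then obtain i n where j: "j = (i, n)" "i \<in> I" by auto
    have "continuous_map X euclideanreal (f i \<circ> (\<lambda>x. (x, False)))"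
      by (rule continuous_map_compose [OF continuous_map_alexandroff_duplicate_bottom
            separating_family_continuous [OF f j(2)]])
    then have "continuous_map X euclideanreal (\<lambda>x. tent n (f i (x, False)))"
      by (intro continuous_map_tent) (simp add: o_def)
    then show "continuous_map X (top_of_set {0..1}) (g j)"
      using f01 [OF j(2)] by (auto simp: g_def j(1) continuous_map_unit_interval tent_bounds)
  next
    fix x y assume xy: "x \<in> topspace X" "y \<in> topspace X" and e: "\<And>j. j \<in> ?J \<Longrightarrow> g j x = g j y"
    have "f i (x, False) = f i (y, False)" if "i \<in> I" for i
    proof (rule tent_eqD)
      show "tent n (f i (x, False)) = tent n (f i (y, False))" for n
        using e [of "(i, n)"] that by (simp add: g_def)
    qed (use f01 [OF that] xy in auto)
    then have "(x, False) = (y, False)"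
      using xy by (intro separating_family_eqI [OF f]) auto
    then show "x = y" by simp
  qed
  moreover have "finite (C j)" if "j \<in> ?J" for j
  proof -
    from that obtain i n where j: "j = (i, n)" "i \<in> I" by auto
    have "C j \<subseteq> {x \<in> topspace X. \<bar>f i (x, False) - f i (x, True)\<bar> \<ge> 1 / (real n + 2)}"
    proof
      fix x assume "x \<in> C j"
      then have "x \<in> topspace X" "1 < (real n + 2) * f i (x, False)" "f i (x, True) = 0"
        by (auto simp: C_def j(1) tent_neq_0_iff)
      then show "x \<in> {x \<in> topspace X. \<bar>f i (x, False) - f i (x, True)\<bar> \<ge> 1 / (real n + 2)}"
        using f01(1) [OF j(2), of "(x, False)"] by (simp add: field_simps)
    qed
    moreover have "finite {x \<in> topspace X. \<bar>f i (x, False) - f i (x, True)\<bar> \<ge> 1 / (real n + 2)}"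
      by (rule finite_jump_alexandroff_duplicate [OF X separating_family_continuous [OF f j(2)]]) simp
    ultimately show ?thesis by (rule finite_subset)
  qed
  moreover have "finite {j\<in>?J. g j x \<noteq> 0 \<and> x \<notin> C j}" if x: "x \<in> topspace X" for x
  proof (rule finite_subset)
    show "{j\<in>?J. g j x \<noteq> 0 \<and> x \<notin> C j}
        \<subseteq> (SIGMA i:{i\<in>I. f i (x, True) \<noteq> 0}. {n. tent n (f i (x, False)) \<noteq> 0})"
      using x by (auto simp: g_def C_def)
    show "finite (SIGMA i:{i\<in>I. f i (x, True) \<noteq> 0}. {n. tent n (f i (x, False)) \<noteq> 0})"
      using fin x finite_tent by (intro finite_SigmaI) auto
  qed
  ultimately obtain L :: "('a + (('a \<times> bool \<Rightarrow> real) \<times> nat) \<times> nat) set" and h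
    where "separating_family X L h" "point_finite X L h"
    by (rule point_finite_separating_family_of_exceptions)
  then show ?thesis using X by (intro separating_family_imp_omega_Corson)
qed

theorem theorem4p9:
  fixes K :: "'a topology"
  assumes "compact_space K" and "Hausdorff_space K"
  shows "(omega_Corson K \<longleftrightarrow> omega_Corson (alexandroff_duplicate K)) \<and>
         (omega_Corson (alexandroff_duplicate K) \<longleftrightarrow> omega_Valdivia (alexandroff_duplicate K))"
  using omega_Corson_alexandroff_duplicate [of K] omega_Corson_imp_omega_Valdivia
    omega_Valdivia_alexandroff_duplicate_imp_omega_Corson [OF assms(1)]
  by blast

end
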